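(* For the collection of DNFs $\mathrm{LOP}_n$ (defined below), there exists a degree $n/300$ $\Sigma_2$-pseudo-expectation.
   Context: Variables $x_{i,j}$, $i,j\in[n]$. $\mathrm{LOP}_n$ is the collection of the following DNFs (each term is a single literal): $M_i=\bigvee_{j\in[n]\setminus\{i\}}x_{j,i}$ for $i\in[n]$; $R_i=\neg x_{i,i}$ for $i\in[n]$; $A_{i,j}=\neg x_{i,j}\vee\neg x_{j,i}$ for distinct $i,j$; $T_{i,j,k}=x_{i,k}\vee\neg x_{i,j}\vee\neg x_{j,k}$ for distinct $i,j,k$; $O_{i,j}=x_{i,j}\vee\neg x_{i,j}$ for distinct $i,j$. To a term $t$ associate $t(x)=\prod_{\text{positive }x_{i,j}\in t}x_{i,j}\prod_{\text{negated }x_{i,j}\in t}(1-x_{i,j})$; a DNF $D=\bigvee_{t\in D}t$ is associated with the polynomial $\sum_{t\in D}t(x)-1$ of degree $\max_{t\in D}\deg t$. Arithmetic is multilinear. A conical junta is a finite sum of term polynomials. A $\Sigma_2$-weakening of a DNF $D$ is a collection of DNFs each implied by $D$; a $\Sigma_2$-weakening of a collection of DNFs is a collection of $\Sigma_2$-weakenings of those DNFs. A degree-$d$ pseudo-expectation for a collection of DNFs $F=\{D_i\}$ is a linear map $\tilde{\mathbb{E}}:\mathbb{R}[x]\to\mathbb{R}$ with $\tilde{\mathbb{E}}[1]=1$, $\tilde{\mathbb{E}}[\mathcal{J}]\ge0$ for every conical junta of degree at most $d$, and $\tilde{\mathbb{E}}[D_i\mathcal{J}]\ge0$ for every $D_i\in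 F$ and conical junta $\mathcal{J}$ with $\deg(D_i\mathcal{J})\le d$. A degree-$d$ $\Sigma_2$-pseudo-expectation for $F$ is a family of degree-$d$ pseudo-expectations, one for every $\Sigma_2$-weakening of $F$.
   Formalization: The case n = 1 is excluded: there M_1 is the empty disjunction with polynomial −1, so a pseudo-expectation would need Ẽ[−1] ≥ 0, contradicting Ẽ[1] = 1, and the claim fails. *)

theory Defs
  imports Complex_Main "HOL-Library.FSet" "HOL-Library.Multiset" "HOL-Library.Poly_Mapping"
begin

section \<open>Multilinear polynomials\<close>

text \<open>Monomials are finite sets of variables, multiplied by union. The polynomial ring over this
  idempotent monoid is \<open>\<real>[x]/(x\<^sub>v\<^sup>2 - x\<^sub>v)\<close>, so multiplication in it is multilinear.\<close>

datatype 'v mlmon = Mon (mon_vars: "'v fset")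

instantiation mlmon :: (type) comm_monoid_add
begin
definition zero_mlmon :: "'a mlmon" where "0 = Mon {||}"
definition plus_mlmon :: "'a mlmon \<Rightarrow> 'a mlmon \<Rightarrow> 'a mlmon" where
  "m + m' = Mon (mon_vars m |\<union>| mon_vars m')"
instance
  by standard (auto simp: zero_mlmon_def plus_mlmon_def)
end

instantiation poly_mapping :: (type, real_vector) real_vector
begin
lift_definition scaleR_poly_mapping :: "real \<Rightarrow> ('a \<Rightarrow>\<^sub>0 'b) \<Rightarrow> 'a \<Rightarrow>\<^sub>0 'b"
  is "\<lambda>c p m. c *\<^sub>R p m"
  by (rule finite_subset[rotated]) auto
instance
  by standard (transfer; auto simp: fun_eq_iff scaleR_add_right scaleR_add_left)+
end

type_synonym 'v mlpoly = "'v mlmon \<Rightarrow>\<^sub>0 real"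

definition var :: "'v \<Rightarrow> 'v mlpoly" where
  "var v = Poly_Mapping.single (Mon {|v|}) 1"

definition mldeg :: "'v mlpoly \<Rightarrow> nat" where
  "mldeg p = Max (insert 0 ((\<lambda>m. fcard (mon_vars m)) ` Poly_Mapping.keys p))"

lemma var_idem: "var v * var v = var v"
  by (simp add: var_def mult_single plus_mlmon_def)

section \<open>DNFs and conical juntas\<close>

datatype 'v lit = Pos 'v | Neg 'v

text \<open>A conjunctive term is the set of its literals; a DNF is the set of its terms.\<close>

type_synonym 'v conj = "'v lit set"
type_synonym 'v dnf = "'v conj set"

definition conjs :: "'v set \<Rightarrow> 'v conj set" where
  "conjs V = Pow (Pos ` V \<union> Neg ` V)"

definition dnfs :: "'v set \<Rightarrow> 'v dnf set" where
  "dnfs V = Pow (conjs V)"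

fun lit_holds :: "('v \<Rightarrow> bool) \<Rightarrow> 'v lit \<Rightarrow> bool" where
  "lit_holds \<alpha> (Pos v) \<longleftrightarrow> \<alpha> v"
| "lit_holds \<alpha> (Neg v) \<longleftrightarrow> \<not> \<alpha> v"

definition dnf_holds :: "('v \<Rightarrow> bool) \<Rightarrow> 'v dnf \<Rightarrow> bool" where
  "dnf_holds \<alpha> D \<longleftrightarrow> (\<exists>t\<in>D. \<forall>l\<in>t. lit_holds \<alpha> l)"

definition dnf_implies :: "'v dnf \<Rightarrow> 'v dnf \<Rightarrow> bool" where
  "dnf_implies D D' \<longleftrightarrow> (\<forall>\<alpha>. dnf_holds \<alpha> D \<longrightarrow> dnf_holds \<alpha> D')"

fun lit_poly :: "'v lit \<Rightarrow> 'v mlpoly" where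
  "lit_poly (Pos v) = var v"
| "lit_poly (Neg v) = 1 - var v"

definition conj_poly :: "'v conj \<Rightarrow> 'v mlpoly" where
  "conj_poly t = (\<Prod>l\<in>t. lit_poly l)"

definition dnf_poly :: "'v dnf \<Rightarrow> 'v mlpoly" where
  "dnf_poly D = (\<Sum>t\<in>D. conj_poly t) - 1"

text \<open>A conical junta is represented by the multiset of the terms it sums.\<close>

type_synonym 'v junta = "'v conj multiset"

definition juntas :: "'v set \<Rightarrow> 'v junta set" where
  "juntas V = {J. set_mset J \<subseteq> conjs V}"

definition junta_poly :: "'v junta \<Rightarrow> 'v mlpoly" where
  "junta_poly J = (\<Sum>t\<in>#J. conj_poly t)"

text \<open>Degrees of DNFs, of juntas and of products of the two are those of the sums by which they
  are presented: the largest degree of a summand, without cancellation between summands. (If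
  cancellation were allowed, every integer-valued nonnegative function of low degree on the cube
  would be a conical junta of low degree, as it is a sum of full-width terms.) The summands of a
  DNF are its terms and the constant \<open>-1\<close>, whose sign does not matter here; each single product of
  summands is computed multilinearly.\<close>

definition sum_degree :: "'v mlpoly set \<Rightarrow> nat" where
  "sum_degree S = Max (insert 0 (mldeg ` S))"

definition dnf_summands :: "'v dnf \<Rightarrow> 'v mlpoly set" where
  "dnf_summands D = insert 1 (conj_poly ` D)"

definition junta_summands :: "'v junta \<Rightarrow> 'v mlpoly set" where
  "junta_summands J = conj_poly ` set_mset J"

definition junta_degree :: "'v junta \<Rightarrow> nat" where
  "junta_degree J = sum_degree (junta_summands J)"

definition prod_degree :: "'v dnf \<Rightarrow> 'v junta \<Rightarrow> nat" where
  "prod_degree D J = sum_degree {p * q | p q. p \<in> dnf_summands D \<and> q \<in> junta_summands J}"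

section \<open>Weakenings and pseudo-expectations\<close>

text \<open>\<open>V\<close> is the finite set of variables at hand. A linear map on the polynomials in \<open>V\<close> is
  represented by one on all of \<open>'v mlpoly\<close>, to which it always extends; it is only constrained on
  polynomials in \<open>V\<close>.\<close>

definition pseudo_expectation ::
    "'v set \<Rightarrow> real \<Rightarrow> 'v dnf set \<Rightarrow> ('v mlpoly \<Rightarrow> real) \<Rightarrow> bool" where
  "pseudo_expectation V d F E \<longleftrightarrow>
     linear E \<and> E 1 = 1 \<and>
     (\<forall>J\<in>juntas V. real (junta_degree J) \<le> d \<longrightarrow> E (junta_poly J) \<ge> 0) \<and>
     (\<forall>D\<in>F. \<forall>J\<in>juntas V. real (prod_degree D J) \<le> d \<longrightarrow> E (dnf_poly D * junta_poly J) \<ge> 0)"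

definition dnf_weakening :: "'v set \<Rightarrow> 'v dnf \<Rightarrow> 'v dnf set \<Rightarrow> bool" where
  "dnf_weakening V D W \<longleftrightarrow> W \<subseteq> dnfs V \<and> (\<forall>D'\<in>W. dnf_implies D D')"

text \<open>A weakening of a collection \<open>F\<close> assigns to each \<open>D \<in> F\<close> a weakening of \<open>D\<close>; the DNFs
  belonging to it are those in the union of all these.\<close>

definition weakening :: "'v set \<Rightarrow> 'v dnf set \<Rightarrow> ('v dnf \<Rightarrow> 'v dnf set) \<Rightarrow> bool" where
  "weakening V F W \<longleftrightarrow> (\<forall>D\<in>F. dnf_weakening V D (W D))"

definition sigma2_pseudo_expectation ::
    "'v set \<Rightarrow> real \<Rightarrow> 'v dnf set \<Rightarrow> (('v dnf \<Rightarrow> 'v dnf set) \<Rightarrow> 'v mlpoly \<Rightarrow> real) \<Rightarrow> bool" where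
  "sigma2_pseudo_expectation V d F E \<longleftrightarrow>
     (\<forall>W. weakening V F W \<longrightarrow> pseudo_expectation V d (\<Union>D\<in>F. W D) (E W))"

section \<open>The linear ordering principle\<close>

definition clause :: "'v lit set \<Rightarrow> 'v dnf" where
  "clause L = (\<lambda>l. {l}) ` L"

definition lop_vars :: "nat \<Rightarrow> (nat \<times> nat) set" where
  "lop_vars n = {1..n} \<times> {1..n}"

definition LOP :: "nat \<Rightarrow> (nat \<times> nat) dnf set" where
  "LOP n =
     {clause {Pos (j, i) | j. j \<in> {1..n} - {i}} | i. i \<in> {1..n}} \<union>
     {clause {Neg (i, i)} | i. i \<in> {1..n}} \<union>
     {clause {Neg (i, j), Neg (j, i)} | i j. i \<in> {1..n} \<and> j \<in> {1..n} \<and> i \<noteq> j} \<union>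
     {clause {Pos (i, k), Neg (i, j), Neg (j, k)} | i j k.
        i \<in> {1..n} \<and> j \<in> {1..n} \<and> k \<in> {1..n} \<and> i \<noteq> j \<and> j \<noteq> k \<and> i \<noteq> k} \<union>
     {clause {Pos (i, j), Neg (i, j)} | i j. i \<in> {1..n} \<and> j \<in> {1..n} \<and> i \<noteq> j}"

text \<open>For \<open>n = 1\<close> the axiom \<open>M\<^sub>1\<close> is the empty DNF, with polynomial \<open>-1\<close>; this rules out
  pseudo-expectations of every degree.\<close>

lemma mldeg_one: "mldeg (1 :: 'v mlpoly) = 0"
proof -
  have "mldeg (Poly_Mapping.single (0::'v mlmon) (1::real)) = 0"
    by (simp add: mldeg_def zero_mlmon_def)
  then show ?thesis by simp
qed

lemma no_pseudo_expectation_LOP_1: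
  assumes "d \<ge> 0"
  shows "\<not> pseudo_expectation (lop_vars 1) d (LOP 1) E"
proof
  assume *: "pseudo_expectation (lop_vars 1) d (LOP 1) E"
  have "{} \<in> LOP 1" by (auto simp: LOP_def clause_def)
  moreover have "{#{}#} \<in> juntas (lop_vars 1)" by (simp add: juntas_def conjs_def)
  moreover have "{p * q | p q. p \<in> dnf_summands {} \<and> q \<in> junta_summands {#{}#}}
      = {1 :: (nat \<times> nat) mlpoly}"
    by (simp add: dnf_summands_def junta_summands_def conj_poly_def)
  then have "real (prod_degree ({} :: (nat \<times> nat) dnf) {#{}#}) \<le> d"
    using assms by (simp add: prod_degree_def sum_degree_def mldeg_one)
  ultimately have "E (dnf_poly {} * junta_poly {#{}#}) \<ge> 0"
    using * by (auto simp: pseudo_expectation_def)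
  then have "E (- 1) \<ge> 0" by (simp add: dnf_poly_def junta_poly_def conj_poly_def)
  moreover have "E (- 1) = - 1"
    using * linear_neg[of E 1] by (simp add: pseudo_expectation_def)
  ultimately show False by simp
qed

corollary no_sigma2_pseudo_expectation_LOP_1:
  assumes "d \<ge> 0"
  shows "\<not> (\<exists>E. sigma2_pseudo_expectation (lop_vars 1) d (LOP 1) E)"
proof
  assume "\<exists>E. sigma2_pseudo_expectation (lop_vars 1) d (LOP 1) E"
  then obtain E where E: "sigma2_pseudo_expectation (lop_vars 1) d (LOP 1) E" ..
  have "weakening (lop_vars 1) (LOP 1) (\<lambda>D. {D})"
    by (auto simp: weakening_def dnf_weakening_def dnf_implies_def dnfs_def conjs_def
        LOP_def clause_def lop_vars_def)
  with E have "pseudo_expectation (lop_vars 1) d (\<Union>D\<in>LOP 1. {D}) (E (\<lambda>D. {D}))"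
    unfolding sigma2_pseudo_expectation_def by blast
  then show False
    using no_pseudo_expectation_LOP_1[OF assms] by simp
qed

end

theory Submission
  imports Defs "HOL-Combinatorics.Multiset_Permutations"
begin

text \<open>A single pseudo-expectation serves every weakening: the mean over a uniformly random linear
  order of \<open>{1..n}\<close>. An order satisfies every axiom except \<open>M\<^sub>i\<close> for its least element \<open>i\<close>, so
  only a weakening \<open>D\<close> of some \<open>M\<^sub>i\<close>, tested against a term \<open>C\<close>, needs an argument, and it can only
  contribute a negative value (namely \<open>- 1\<close>) at orders that satisfy \<open>C\<close>, have \<open>i\<close> least and
  satisfy no term of \<open>D\<close>.

  Fix such an order. Moving an element \<open>j\<close> not mentioned in \<open>C\<close> below \<open>i\<close> makes some term \<open>t\<^sub>j\<close>
  of \<open>D\<close> true, and \<open>t\<^sub>j\<close> must mention \<open>j\<close>. Each \<open>t\<^sub>j\<close> mentions at most \<open>2d\<close> elements, so for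
  most triples \<open>(j, k, l)\<close> none of \<open>t\<^sub>j\<close>, \<open>t\<^sub>k\<close>, \<open>t\<^sub>l\<close> mentions one of the other two elements; these
  three terms are then distinct and all true once \<open>j, k, l\<close> have been moved below \<open>i\<close>, where the
  value is thus at least \<open>2\<close>. An order arises in this way from at most \<open>(n - 1)\<^sup>3\<close> original orders
  for its triple, so double counting shows that the gain outweighs the loss.\<close>

section \<open>Double counting over linear orders\<close>

text \<open>A list in the fibre is determined by the position at which \<open>j\<close> is inserted
  into \<open>zs\<close>, and \<open>zs\<close> offers \<open>length zs + 1\<close>
  positions.\<close>

lemma card_reinsertions_le:
  assumes "finite B" "j \<in> B"
  shows "card {ys \<in> permutations_of_set B. filter (\<lambda>x. x \<noteq> j) ys = zs} \<le> card B"
\<comment> \<open>Only a nonempty fibre forces \<open>zs\<close> to be shorter than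
  \<open>card B\<close>.\<close>
proof (cases "{ys \<in> permutations_of_set B. filter (\<lambda>x. x \<noteq> j) ys = zs} = {}")
  case False
  let ?f = "\<lambda>p. take p zs @ j # drop p zs"
  have split: "\<exists>us vs. ys = us @ j # vs \<and> zs = us @ vs"
    if "ys \<in> permutations_of_set B" "filter (\<lambda>x. x \<noteq> j) ys = zs" for ys
  proof -
    have "j \<in> set ys" using assms(2) permutations_of_setD(1)[OF that(1)] by simp
    then obtain us vs where ys: "ys = us @ j # vs" by (meson split_list)
    moreover have "filter (\<lambda>x. x \<noteq> j) us = us" "filter (\<lambda>x. x \<noteq> j) vs = vs"
      using permutations_of_setD(2)[OF that(1)] ys by (auto simp: filter_id_conv)
    ultimately show ?thesis using that(2) by auto
  qed
  from False obtain ys where ys: "ys \<in> permutations_of_set B" "filter (\<lambda>x. x \<noteq> j) ys = zs" by blast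
  have "length zs < card B"
    using split[OF ys] length_finite_permutations_of_set[OF ys(1)] by auto
  moreover have "{ys \<in> permutations_of_set B. filter (\<lambda>x. x \<noteq> j) ys = zs} \<subseteq> ?f ` {..length zs}"
  proof
    fix ys assume "ys \<in> {ys \<in> permutations_of_set B. filter (\<lambda>x. x \<noteq> j) ys = zs}"
    with split obtain us vs where "ys = us @ j # vs" "zs = us @ vs" by blast
    then have "ys = ?f (length us)" "length us \<le> length zs" by auto
    then show "ys \<in> ?f ` {..length zs}" by blast
  qed
  then have "card {ys \<in> permutations_of_set B. filter (\<lambda>x. x \<noteq> j) ys = zs} \<le> card {..length zs}"
    by (rule surj_card_le[rotated]) simp
  ultimately show ?thesis by simp
next
  case True
  show ?thesis unfolding True by simp
qed

lemma filter_permutations_of_set: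
  "ys \<in> permutations_of_set B \<Longrightarrow> filter (\<lambda>x. x \<notin> K) ys \<in> permutations_of_set (B - K)"
  by (auto simp: permutations_of_set_def)

text \<open>The elements of \<open>K\<close> are deleted one at a time, and each deletion has fibres
  of size at most \<open>card B\<close>. The exact factor is a falling factorial; the power bounds
  it because \<open>H\<close> is nonnegative.\<close>

lemma sum_filter_permutations_le:
  fixes H :: "'a list \<Rightarrow> real"
  assumes "finite K" "finite B" "K \<subseteq> B"
    and "\<And>zs. zs \<in> permutations_of_set (B - K) \<Longrightarrow> H zs \<ge> 0"
  shows "(\<Sum>ys\<in>permutations_of_set B. H (filter (\<lambda>x. x \<notin> K) ys))
    \<le> real (card B) ^ card K * (\<Sum>zs\<in>permutations_of_set (B - K). H zs)"
  using assms
proof (induction K arbitrary: B rule: finite_induct)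
  case empty
  then show ?case by simp
next
  case (insert j K)
  let ?P = permutations_of_set
  have j: "j \<in> B" "finite B" using insert.prems by auto
  have B: "B - insert j K = B - {j} - K" by auto
  define H' where "H' zs = H (filter (\<lambda>x. x \<notin> K) zs)" for zs
  have pos: "H' zs \<ge> 0" if "zs \<in> ?P (B - {j})" for zs
    using insert.prems(3) filter_permutations_of_set[OF that, of K] by (simp add: H'_def B)
  have "(\<Sum>ys\<in>?P B. H (filter (\<lambda>x. x \<notin> insert j K) ys))
      = (\<Sum>ys\<in>?P B. H' (filter (\<lambda>x. x \<noteq> j) ys))"
    unfolding H'_def by (intro sum.cong refl arg_cong[of _ _ H]) (auto intro!: filter_cong)
  also have "\<dots> = (\<Sum>zs\<in>?P (B - {j}). \<Sum>ys\<in>{ys \<in> ?P B. filter (\<lambda>x. x \<noteq> j) ys = zs}.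
      H' (filter (\<lambda>x. x \<noteq> j) ys))"
    using filter_permutations_of_set[of _ B "{j}"]
    by (intro sum.group[symmetric]) auto
  also have "\<dots> = (\<Sum>zs\<in>?P (B - {j}).
      real (card {ys \<in> ?P B. filter (\<lambda>x. x \<noteq> j) ys = zs}) * H' zs)"
    by (intro sum.cong refl) simp
  also have "\<dots> \<le> (\<Sum>zs\<in>?P (B - {j}). real (card B) * H' zs)"
    using card_reinsertions_le[OF j(2,1)] pos by (intro sum_mono mult_right_mono) auto
  also have "\<dots> = real (card B) * (\<Sum>zs\<in>?P (B - {j}). H' zs)"
    by (simp add: sum_distrib_left)
  also have "(\<Sum>zs\<in>?P (B - {j}). H' zs)
      \<le> real (card (B - {j})) ^ card K * (\<Sum>zs\<in>?P (B - {j} - K). H zs)"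
    unfolding H'_def using insert.prems insert.hyps by (intro insert.IH) (auto simp: B)
  also have "\<dots> \<le> real (card B) ^ card K * (\<Sum>zs\<in>?P (B - {j} - K). H zs)"
    using j insert.prems(3)
    by (intro mult_right_mono power_mono sum_nonneg) (auto simp: card_Diff1_le B)
  finally show ?case
    using insert.hyps insert.prems(2) by (simp add: B mult_left_mono mult.assoc)
qed

text \<open>Union bound: a triple fails if one of its entries lies in the set of another. There are
  six ordered pairs of positions, each spoiling at most \<open>card F * r * card F\<close>
  triples.\<close>

lemma card_unmentioned_triples:
  fixes e :: "'a \<Rightarrow> 'a set"
  assumes "finite F" "\<And>j. j \<in> F \<Longrightarrow> finite (e j)" "\<And>j. j \<in> F \<Longrightarrow> card (e j) \<le> r"
  shows "real (card F) ^ 2 * (real (card F) - 6 * real r) \<le> real (card {(j, k, l).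
     j \<in> F \<and> k \<in> F \<and> l \<in> F \<and> k \<notin> e j \<and> l \<notin> e j \<and> j \<notin> e k \<and> l \<notin> e k \<and> j \<notin> e l \<and> k \<notin> e l})"
    (is "_ \<le> real (card ?G)")
proof -
  define S where "S = Sigma F (\<lambda>j. e j \<inter> F)"
  have fS: "finite S" unfolding S_def using assms by blast
  have cS: "card S \<le> card F * r"
  proof -
    have "card S = (\<Sum>j\<in>F. card (e j \<inter> F))"
      unfolding S_def using assms by (intro card_SigmaI) auto
    also have "\<dots> \<le> (\<Sum>j\<in>F. r)"
      using assms by (intro sum_mono) (meson card_mono inf_le1 le_trans)
    finally show ?thesis by simp
  qed
  \<comment> \<open>The six ways to place a bad pair \<open>(a, b)\<close> and a free entry
    \<open>c\<close> in a triple. A list is used so that its length bounds the number of maps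
    without a proof that they differ.\<close>
  define fs :: "(('a \<times> 'a) \<times> 'a \<Rightarrow> 'a \<times> 'a \<times> 'a) list" where
    "fs = [\<lambda>((a, b), c). (a, b, c), \<lambda>((a, b), c). (b, a, c), \<lambda>((a, b), c). (a, c, b),
      \<lambda>((a, b), c). (b, c, a), \<lambda>((a, b), c). (c, a, b), \<lambda>((a, b), c). (c, b, a)]"
  let ?U = "\<Union>f\<in>set fs. f ` (S \<times> F)"
  have B: "card (f ` (S \<times> F)) \<le> card F * r * card F" for f :: "('a \<times> 'a) \<times> 'a \<Rightarrow> 'a \<times> 'a \<times> 'a"
  proof -
    have "card (f ` (S \<times> F)) \<le> card S * card F"
      using card_image_le[of "S \<times> F" f] fS assms(1) by (simp add: card_cartesian_product)
    also have "\<dots> \<le> card F * r * card F" using cS by (rule mult_right_mono) simp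
    finally show ?thesis .
  qed
  have "F \<times> F \<times> F \<subseteq> ?G \<union> ?U"
  proof
    fix p assume "p \<in> F \<times> F \<times> F"
    then obtain j k l where p: "p = (j, k, l)" "j \<in> F" "k \<in> F" "l \<in> F" by auto
    have U: "p \<in> ?U" if "f ((a, b), c) = p" "f \<in> set fs" "(a, b) \<in> S" "c \<in> F" for f a b c
      using that by (metis UN_I image_eqI mem_Sigma_iff)
    consider "p \<in> ?G" | "(j, k) \<in> S" | "(k, j) \<in> S" | "(j, l) \<in> S" | "(l, j) \<in> S"
      | "(k, l) \<in> S" | "(l, k) \<in> S"
      using p unfolding S_def by blast
    then show "p \<in> ?G \<union> ?U"
    proof cases
      case 1 then show ?thesis by blast
    next
      case 2 then show ?thesis using U[of "fs ! 0" j k l] p by (simp add: fs_def)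
    next
      case 3 then show ?thesis using U[of "fs ! 1" k j l] p by (simp add: fs_def)
    next
      case 4 then show ?thesis using U[of "fs ! 2" j l k] p by (simp add: fs_def)
    next
      case 5 then show ?thesis using U[of "fs ! 3" l j k] p by (simp add: fs_def)
    next
      case 6 then show ?thesis using U[of "fs ! 4" k l j] p by (simp add: fs_def)
    next
      case 7 then show ?thesis using U[of "fs ! 5" l k j] p by (simp add: fs_def)
    qed
  qed
  moreover have "finite ?G"
    by (rule finite_subset[of _ "F \<times> F \<times> F"]) (use assms(1) in auto)
  ultimately have "card (F \<times> F \<times> F) \<le> card (?G \<union> ?U)"
    using fS assms(1) by (intro card_mono) auto
  also have "\<dots> \<le> card ?G + card ?U" by (rule card_Un_le)
  also have "card ?U \<le> (\<Sum>f\<in>set fs. card (f ` (S \<times> F)))"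
    by (rule card_UN_le) simp
  also have "\<dots> \<le> (\<Sum>f\<in>set fs. card F * r * card F)" by (intro sum_mono B)
  also have "\<dots> = card (set fs) * (card F * r * card F)" by simp
  also have "\<dots> \<le> 6 * (card F * r * card F)"
    using card_length[of fs] by (intro mult_right_mono) (simp_all add: fs_def)
  finally have "card F ^ 3 \<le> card ?G + 6 * (card F * r * card F)"
    by (simp add: card_cartesian_product power3_eq_cube mult.assoc)
  then have "real (card F ^ 3) \<le> real (card ?G + 6 * (card F * r * card F))"
    by (rule of_nat_mono)
  then show ?thesis by (simp add: algebra_simps power2_eq_square power3_eq_cube)
qed

text \<open>The core inequality, with terms reduced to their truth \<open>sat\<close> at an order
  and the set \<open>el\<close> of elements they mention. The width bound is asked only where
  \<open>C\<close> and \<open>t\<close> hold together, since the degree says nothing about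
  contradictory terms.\<close>

lemma sum_satisfied_terms_ge:
  fixes sat :: "'a list \<Rightarrow> 't \<Rightarrow> bool" and el :: "'t \<Rightarrow> 'a set"
  assumes A: "finite A" "i \<in> A" "card A \<ge> 2" "300 * d \<le> card A" and D: "finite D"
    and local: "\<And>xs ys t. filter (\<lambda>x. x \<in> el t) xs = filter (\<lambda>x. x \<in> el t) ys \<Longrightarrow> sat xs t = sat ys t"
    and width: "\<And>xs t. xs \<in> permutations_of_set A \<Longrightarrow> sat xs C \<Longrightarrow> t \<in> insert C D \<Longrightarrow> sat xs t
      \<Longrightarrow> finite (el t) \<and> card (el t) \<le> 2 * d"
    and cover: "\<And>x xs. x # xs \<in> permutations_of_set A \<Longrightarrow> x \<noteq> i \<Longrightarrow> \<exists>t\<in>D. sat (x # xs) t"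
  shows "0 \<le> (\<Sum>xs\<in>permutations_of_set A. of_bool (sat xs C) * (real (card {t \<in> D. sat xs t}) - 1))"
proof -
  let ?P = permutations_of_set
  define B where "B = A - {i}"
  define q where "q = card B"
  define P0 where "P0 = {ys \<in> ?P B. sat (i # ys) C \<and> (\<forall>t\<in>D. \<not> sat (i # ys) t)}"
  define g where "g xs = of_bool (sat xs C) * (real (card {t \<in> D. sat xs t}) - 1)" for xs
  have B: "finite B" "card A = Suc q" "q \<ge> 1" "i \<notin> B" "insert i B = A"
    using A by (auto simp: B_def q_def card_Diff_singleton)
  have fP0: "finite P0" unfolding P0_def by simp
  have nonneg_if: "g xs \<ge> 0" if "t \<in> D" "sat xs t" for t xs
  proof -
    have "card {t \<in> D. sat xs t} > 0" using that D by (auto simp: card_gt_0_iff)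
    then show ?thesis by (simp add: g_def)
  qed
  have nonneg: "g xs \<ge> 0" if xs: "xs \<in> ?P A" and n: "xs \<notin> (#) i ` P0" for xs
  proof (cases xs)
    case Nil
    then show ?thesis using xs A(2) by (auto dest: permutations_of_setD(1))
  next
    case (Cons x ys)
    show ?thesis
    proof (cases "x = i")
      case False
      then show ?thesis using cover xs Cons nonneg_if by blast
    next
      case True
      have "ys \<in> ?P B" using xs Cons True by (auto simp: permutations_of_set_def B_def)
      then have "\<not> sat xs C \<or> (\<exists>t\<in>D. sat xs t)" using n Cons True by (auto simp: P0_def)
      then show ?thesis using nonneg_if by (cases "sat xs C") (blast, simp add: g_def)
    qed
  qed
  have min: "g (i # ys) = - 1" if "ys \<in> P0" for ys
  proof -
    have "{t \<in> D. sat (i # ys) t} = {}" using that by (auto simp: P0_def)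
    then have "card {t \<in> D. sat (i # ys) t} = 0" by (simp only: card.empty)
    moreover have "sat (i # ys) C" using that by (simp add: P0_def)
    ultimately show ?thesis unfolding g_def by (simp only: of_bool_eq) simp
  qed
  have "0 \<le> (\<Sum>xs\<in>?P A. g xs)"
  proof (cases "P0 = {}")
    case True
    then show ?thesis using nonneg by (intro sum_nonneg) auto
  next
    case False
    define F where "F = B - el C"
    have fF: "finite F" using B by (simp add: F_def)
    have PA: "i # ys \<in> ?P A" if "ys \<in> ?P B" for ys
      using that B by (auto simp: permutations_of_set_def)
    obtain ys0 where ys0: "ys0 \<in> P0" using False by blast
    then have eC: "finite (el C)" "card (el C) \<le> 2 * d"
      using width[of "i # ys0" C] PA by (auto simp: P0_def)
    \<comment> \<open>With \<open>j\<close> least, some term of \<open>D\<close> holds. Had it not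
      mentioned \<open>j\<close>, locality would make it true at \<open>i # ys\<close> already,
      contrary to \<open>ys \<in> P0\<close>. The term \<open>C\<close> survives the move because it
      does not mention \<open>j\<close>.\<close>
    have "\<exists>t\<in>D. sat (j # i # filter (\<lambda>x. x \<noteq> j) ys) t \<and> j \<in> el t \<and> finite (el t) \<and> card (el t) \<le> 2 * d"
      if ys: "ys \<in> P0" and j: "j \<in> F" for ys j
    proof -
      let ?xs = "j # i # filter (\<lambda>x. x \<noteq> j) ys"
      have ji: "j \<noteq> i" "j \<in> B" "j \<notin> el C" using j B by (auto simp: F_def)
      have xs: "?xs \<in> ?P A" using ys ji B by (auto simp: permutations_of_set_def P0_def)
      have same: "sat ?xs t = sat (i # ys) t" if "j \<notin> el t" for t
        using that by (intro local) (auto intro: filter_cong)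
      obtain t where t: "t \<in> D" "sat ?xs t" using cover[OF xs ji(1)] by blast
      have "j \<in> el t" using t same ys by (auto simp: P0_def)
      moreover have "sat ?xs C" using same ji ys by (auto simp: P0_def)
      ultimately show ?thesis using t width[OF xs] by blast
    qed
    then obtain w where w: "\<And>ys j. ys \<in> P0 \<Longrightarrow> j \<in> F \<Longrightarrow> w ys j \<in> D
        \<and> sat (j # i # filter (\<lambda>x. x \<noteq> j) ys) (w ys j) \<and> j \<in> el (w ys j)
        \<and> finite (el (w ys j)) \<and> card (el (w ys j)) \<le> 2 * d" by metis
    define e where "e ys j = el (w ys j)" for ys j
    have cF: "real q - 2 * real d \<le> real (card F)"
    proof -
      have "q - card (el C) \<le> card F" unfolding F_def q_def by (rule diff_card_le_card_Diff[OF eC(1)])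
      then show ?thesis using eC(2) by linarith
    qed
    \<comment> \<open>A term that mentions \<open>j\<close> has positive width, so
      \<open>d = 0\<close> is impossible. Hence \<open>300 * d \<le> q + 1\<close> can be weakened
      to \<open>299 * d \<le> q\<close>.\<close>
    have d1: "d \<ge> 1"
    proof (rule ccontr)
      assume "\<not> d \<ge> 1"
      then have "card F > 0" using cF B(3) by linarith
      then obtain j where j: "j \<in> F" by (auto simp: card_gt_0_iff)
      then have "card (el (w ys0 j)) > 0" using w[OF ys0 j] card_gt_0_iff by blast
      then show False using w[OF ys0 j] \<open>\<not> d \<ge> 1\<close> by linarith
    qed
    have dq: "299 * real d \<le> real q" using d1 A(4) B(2) by linarith
    define Good where "Good ys = {(j, k, l). j \<in> F \<and> k \<in> F \<and> l \<in> F \<and> k \<notin> e ys j \<and> l \<notin> e ys j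
      \<and> j \<notin> e ys k \<and> l \<notin> e ys k \<and> j \<notin> e ys l \<and> k \<notin> e ys l}" for ys
    have good: "real q ^ 3 \<le> 2 * real (card (Good ys))" if ys: "ys \<in> P0" for ys
    proof -
      have "real (card F) ^ 2 * (real (card F) - 6 * real (2 * d)) \<le> real (card (Good ys))"
        unfolding Good_def by (intro card_unmentioned_triples fF) (use w[OF ys] in \<open>auto simp: e_def\<close>)
      \<comment> \<open>From \<open>d \<le> q / 299\<close>: \<open>card F\<close> is at least
        \<open>q - 2 * d\<close>, thus at least \<open>297 / 299 * q\<close>, and subtracting
        another \<open>12 * d\<close> leaves at least \<open>285 / 299 * q\<close>. The product is
        about \<open>0.94 * q ^ 3\<close>, well above half of \<open>q ^ 3\<close>.\<close>
      moreover have "(297 / 299 * real q) ^ 2 * (285 / 299 * real q)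
          \<le> real (card F) ^ 2 * (real (card F) - 6 * real (2 * d))"
        using cF dq by (intro mult_mono power_mono) auto
      moreover have "real q ^ 3 \<le> 2 * ((297 / 299 * real q) ^ 2 * (285 / 299 * real q))"
        by (simp add: power2_eq_square power3_eq_cube)
      ultimately show ?thesis by linarith
    qed
    define T where "T = {(j, k, l). j \<in> F \<and> k \<in> F \<and> l \<in> F \<and> j \<noteq> k \<and> j \<noteq> l \<and> k \<noteq> l}"
    define pre where "pre = (\<lambda>(j, k, l). [j, k, l :: 'a])"
    have fT: "finite T" by (rule finite_subset[of _ "F \<times> F \<times> F"]) (use fF in \<open>auto simp: T_def\<close>)
    have T: "set (pre \<tau>) \<subseteq> B" "set (pre \<tau>) \<inter> el C = {}" "length (pre \<tau>) = 3" "distinct (pre \<tau>)"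
      "pre \<tau> \<noteq> []" "hd (pre \<tau>) \<noteq> i" if "\<tau> \<in> T" for \<tau>
      using that B(4) by (auto simp: T_def pre_def F_def)
    \<comment> \<open>The entries of a good triple differ because each is mentioned by its own
      witness and by neither of the others.\<close>
    have GT: "Good ys \<subseteq> T" if "ys \<in> P0" for ys
      using w[OF that] by (auto simp: Good_def T_def e_def)
    have pA: "pre \<tau> @ i # zs \<in> ?P A" if "\<tau> \<in> T" "zs \<in> ?P (B - set (pre \<tau>))" for \<tau> zs
      using that T[OF that(1)] B by (auto simp: permutations_of_set_def)
    have hd: "pre \<tau> @ i # zs \<notin> (#) i ` P0" if "\<tau> \<in> T" for \<tau> zs
      using T[OF that] by (cases "pre \<tau>") auto
    have pos: "0 \<le> g (pre \<tau> @ i # zs)" if "\<tau> \<in> T" "zs \<in> ?P (B - set (pre \<tau>))" for \<tau> zs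
      using nonneg pA hd that by blast
    have pos_filter: "0 \<le> g (pre \<tau> @ i # filter (\<lambda>x. x \<notin> set (pre \<tau>)) ys)"
      if "\<tau> \<in> T" "ys \<in> ?P B" for \<tau> ys
      using pos[OF that(1)] filter_permutations_of_set[OF that(2)] .
    have three: "2 \<le> g (pre \<tau> @ i # filter (\<lambda>x. x \<notin> set (pre \<tau>)) ys)"
      if ys: "ys \<in> P0" and \<tau>: "\<tau> \<in> Good ys" for \<tau> ys
    proof -
      obtain j k l where jkl: "\<tau> = (j, k, l)" by (cases \<tau>)
      let ?zs = "filter (\<lambda>x. x \<notin> set (pre \<tau>)) ys" let ?xs = "pre \<tau> @ i # ?zs"
      have \<tau>T: "\<tau> \<in> T" using GT ys \<tau> by blast
      have "filter (\<lambda>x. x \<in> el C) ?xs = filter (\<lambda>x. x \<in> el C) (i # ys)"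
      proof -
        have "filter (\<lambda>x. x \<in> el C) (pre \<tau>) = []" using T(2)[OF \<tau>T] by (auto simp: filter_empty_conv)
        moreover have "filter (\<lambda>x. x \<in> el C) ?zs = filter (\<lambda>x. x \<in> el C) ys"
          using T(2)[OF \<tau>T] unfolding filter_filter by (intro filter_cong) auto
        ultimately show ?thesis by simp
      qed
      then have "sat ?xs C = sat (i # ys) C" by (rule local)
      then have C: "sat ?xs C" using ys by (simp add: P0_def)
      \<comment> \<open>To the witness of \<open>a\<close>, moving the whole triple looks the same
        as moving \<open>a\<close> alone, since it does not mention the other two entries.\<close>
      have one: "w ys a \<in> D \<and> sat ?xs (w ys a)"
        if a: "a \<in> F" "a \<in> set (pre \<tau>)" "\<And>b. b \<in> set (pre \<tau>) \<Longrightarrow> b \<noteq> a \<Longrightarrow> b \<notin> e ys a" for a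
      proof -
        have "filter (\<lambda>x. x \<in> e ys a) ?zs = filter (\<lambda>x. x \<in> e ys a) (filter (\<lambda>x. x \<noteq> a) ys)"
          using a unfolding filter_filter by (intro filter_cong) auto
        moreover have "filter (\<lambda>x. x \<in> e ys a) (pre \<tau>) = [a]"
          using a(2,3) w[OF ys a(1)] T(4)[OF \<tau>T] by (auto simp: jkl pre_def e_def)
        ultimately have "filter (\<lambda>x. x \<in> e ys a) ?xs
            = filter (\<lambda>x. x \<in> e ys a) (a # i # filter (\<lambda>x. x \<noteq> a) ys)"
          using w[OF ys a(1)] by (simp add: e_def)
        then have "sat ?xs (w ys a) = sat (a # i # filter (\<lambda>x. x \<noteq> a) ys) (w ys a)"
          unfolding e_def by (rule local)
        then show ?thesis using w[OF ys a(1)] by simp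
      qed
      have "finite {t \<in> D. sat ?xs t}" using D by simp
      moreover have "{w ys j, w ys k, w ys l} \<subseteq> {t \<in> D. sat ?xs t}"
        using one[of j] one[of k] one[of l] \<tau> by (auto simp: jkl pre_def Good_def)
      moreover have "card {w ys j, w ys k, w ys l} = 3"
      proof -
        have "j \<in> F" "k \<in> F" "l \<in> F" using \<tau> by (auto simp: jkl Good_def)
        then have "w ys j \<noteq> w ys k" "w ys j \<noteq> w ys l" "w ys k \<noteq> w ys l"
          using w[OF ys] \<tau> unfolding jkl Good_def e_def by auto
        then show ?thesis by simp
      qed
      ultimately have "3 \<le> card {t \<in> D. sat ?xs t}"
        by (metis card_mono)
      then show ?thesis using C by (simp add: g_def)
    qed
    let ?S = "\<Sum>\<tau>\<in>T. \<Sum>zs\<in>?P (B - set (pre \<tau>)). g (pre \<tau> @ i # zs)"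
    \<comment> \<open>Double counting of pairs of a bad order and a good triple: each bad order
      yields gains of total at least \<open>q ^ 3\<close>, while for a fixed triple each modified
      order arises from at most \<open>q ^ 3\<close> orders of \<open>B\<close>.\<close>
    have "real (card P0) * real q ^ 3 \<le> real q ^ 3 * ?S"
    proof -
      have "real (card P0) * real q ^ 3 = (\<Sum>ys\<in>P0. real q ^ 3)" by simp
      also have "\<dots> \<le> (\<Sum>ys\<in>P0. 2 * real (card (Good ys)))" by (intro sum_mono good)
      also have "\<dots> = (\<Sum>ys\<in>P0. \<Sum>\<tau>\<in>T. 2 * of_bool (\<tau> \<in> Good ys))"
      proof (intro sum.cong refl)
        fix ys assume "ys \<in> P0"
        then have "T \<inter> {\<tau>. \<tau> \<in> Good ys} = Good ys" using GT by blast
        then show "2 * real (card (Good ys)) = (\<Sum>\<tau>\<in>T. 2 * of_bool (\<tau> \<in> Good ys))"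
          using fT by (simp flip: sum_distrib_left add: sum_of_bool_eq)
      qed
      also have "\<dots> = (\<Sum>\<tau>\<in>T. \<Sum>ys\<in>P0. 2 * of_bool (\<tau> \<in> Good ys))" by (rule sum.swap)
      also have "\<dots> \<le> (\<Sum>\<tau>\<in>T. \<Sum>ys\<in>P0. g (pre \<tau> @ i # filter (\<lambda>x. x \<notin> set (pre \<tau>)) ys))"
        using three pos_filter by (intro sum_mono) (auto simp: P0_def)
      \<comment> \<open>Enlarging \<open>P0\<close> to all orders of \<open>B\<close> adds only
        nonnegative values and gives the sum the form to which the fibre bound applies.\<close>
      also have "\<dots> \<le> (\<Sum>\<tau>\<in>T. \<Sum>ys\<in>?P B. g (pre \<tau> @ i # filter (\<lambda>x. x \<notin> set (pre \<tau>)) ys))"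
        by (intro sum_mono sum_mono2) (simp_all add: P0_def subset_iff pos_filter)
      also have "\<dots> \<le> (\<Sum>\<tau>\<in>T. real q ^ 3 * (\<Sum>zs\<in>?P (B - set (pre \<tau>)). g (pre \<tau> @ i # zs)))"
      proof (intro sum_mono)
        fix \<tau> assume "\<tau> \<in> T"
        then show "(\<Sum>ys\<in>?P B. g (pre \<tau> @ i # filter (\<lambda>x. x \<notin> set (pre \<tau>)) ys))
            \<le> real q ^ 3 * (\<Sum>zs\<in>?P (B - set (pre \<tau>)). g (pre \<tau> @ i # zs))"
          using sum_filter_permutations_le[of "set (pre \<tau>)" B "\<lambda>zs. g (pre \<tau> @ i # zs)"] T[of \<tau>] B pos
          by (simp add: q_def distinct_card)
      qed
      also have "\<dots> = real q ^ 3 * ?S" by (simp add: sum_distrib_left)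
      finally show ?thesis .
    qed
    moreover have "real q ^ 3 > 0" using B(3) by simp
    ultimately have key: "real (card P0) \<le> ?S" by (simp add: mult.commute)
    define X where "X = (SIGMA \<tau>:T. ?P (B - set (pre \<tau>)))"
    define h where "h = (\<lambda>(\<tau>, zs). pre \<tau> @ i # zs)"
    \<comment> \<open>The first three entries of a modified order reveal the triple, so no gain is
      counted twice in \<open>?S\<close>. These orders do not start with \<open>i\<close>, which
      keeps them apart from the bad ones.\<close>
    have inj: "inj_on h X" by (auto simp: inj_on_def h_def X_def pre_def)
    have fX: "finite X" unfolding X_def using fT by (intro finite_SigmaI) auto
    have hX: "h ` X \<subseteq> ?P A" using pA by (auto simp: h_def X_def)
    have "h x \<notin> (#) i ` P0" if "x \<in> X" for x
    proof -
      have "fst x \<in> T" using that by (auto simp: X_def)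
      then show ?thesis unfolding h_def case_prod_unfold by (rule hd)
    qed
    then have disj: "h ` X \<inter> (#) i ` P0 = {}" by blast
    have "(\<Sum>xs\<in>h ` X. g xs) = ?S"
      using fT by (subst sum.reindex[OF inj]) (simp add: X_def h_def sum.Sigma case_prod_unfold)
    moreover have "(\<Sum>xs\<in>(#) i ` P0. g xs) = - real (card P0)"
      by (subst sum.reindex) (simp_all add: min)
    ultimately have "0 \<le> (\<Sum>xs\<in>h ` X. g xs) + (\<Sum>xs\<in>(#) i ` P0. g xs)" using key by simp
    also have "\<dots> = (\<Sum>xs\<in>h ` X \<union> (#) i ` P0. g xs)"
      using fX fP0 disj by (intro sum.union_disjoint[symmetric]) auto
    also have "\<dots> \<le> (\<Sum>xs\<in>?P A. g xs)"
      using hX PA nonneg by (intro sum_mono2) (auto simp: P0_def)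
    finally show ?thesis .
  qed
  then show ?thesis by (simp add: g_def)
qed

section \<open>Evaluation and degree of multilinear polynomials\<close>

definition eval_mon :: "('v \<Rightarrow> bool) \<Rightarrow> 'v mlmon \<Rightarrow> real" where
  "eval_mon \<alpha> m = of_bool (\<forall>v. v |\<in>| mon_vars m \<longrightarrow> \<alpha> v)"

definition eval :: "('v \<Rightarrow> bool) \<Rightarrow> 'v mlpoly \<Rightarrow> real" where
  "eval \<alpha> p = (\<Sum>m\<in>Poly_Mapping.keys p. Poly_Mapping.lookup p m * eval_mon \<alpha> m)"

lemma eval_mon_add: "eval_mon \<alpha> (m + m') = eval_mon \<alpha> m * eval_mon \<alpha> m'"
  by (auto simp: eval_mon_def plus_mlmon_def)

lemma eval_single [simp]: "eval \<alpha> (Poly_Mapping.single m c) = c * eval_mon \<alpha> m"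
  by (simp add: eval_def)

lemma eval_one [simp]: "eval \<alpha> 1 = 1"
  by (simp add: eval_def eval_mon_def zero_mlmon_def lookup_one)

lemma eval_add [simp]: "eval \<alpha> (p + q) = eval \<alpha> p + eval \<alpha> q"
  unfolding eval_def
  by (rule setsum_keys_plus_distrib[of "\<lambda>m c. c * eval_mon \<alpha> m"]) (simp_all add: distrib_right)

lemma eval_scaleR [simp]: "eval \<alpha> (c *\<^sub>R p) = c * eval \<alpha> p"
proof -
  have "eval \<alpha> (c *\<^sub>R p)
      = (\<Sum>m\<in>Poly_Mapping.keys p. Poly_Mapping.lookup (c *\<^sub>R p) m * eval_mon \<alpha> m)"
    unfolding eval_def
    by (rule sum.mono_neutral_left) (auto simp: in_keys_iff scaleR_poly_mapping.rep_eq)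
  then show ?thesis
    by (simp add: eval_def scaleR_poly_mapping.rep_eq sum_distrib_left mult.assoc)
qed

lemma linear_eval: "linear (eval \<alpha>)"
  by (rule linearI) simp_all

lemma eval_diff [simp]: "eval \<alpha> (p - q) = eval \<alpha> p - eval \<alpha> q"
  by (rule linear_diff[OF linear_eval])

lemma eval_sum: "eval \<alpha> (sum f S) = (\<Sum>s\<in>S. eval \<alpha> (f s))"
  by (rule linear_sum[OF linear_eval])

lemma mlpoly_monomial_sum:
  fixes p :: "'v mlpoly"
  shows "p = (\<Sum>m\<in>Poly_Mapping.keys p. Poly_Mapping.single m (Poly_Mapping.lookup p m))"
  by (rule poly_mapping_eqI)
    (simp add: lookup_sum lookup_single when_def sum.delta' in_keys_iff)

text \<open>Multilinear reduction does not affect Boolean points: 0 and 1 are idempotent, so the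
  union of variable sets evaluates to a product. The rest is bilinear expansion.\<close>

lemma eval_mult [simp]: "eval \<alpha> (p * q) = eval \<alpha> p * eval \<alpha> q"
proof -
  let ?s = "\<lambda>p m. Poly_Mapping.single m (Poly_Mapping.lookup p m)"
  have "eval \<alpha> (p * q) = eval \<alpha> ((\<Sum>m\<in>Poly_Mapping.keys p. ?s p m) * (\<Sum>m\<in>Poly_Mapping.keys q. ?s q m))"
    using mlpoly_monomial_sum[of p] mlpoly_monomial_sum[of q] by simp
  also have "\<dots> = eval \<alpha> p * eval \<alpha> q"
    by (simp add: sum_product mult_single eval_sum eval_mon_add, simp add: eval_def sum_product mult_ac)
  finally show ?thesis .
qed

lemma eval_conj_poly:
  "finite t \<Longrightarrow> eval \<alpha> (conj_poly t) = of_bool (\<forall>l\<in>t. lit_holds \<alpha> l)"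
proof (induction t rule: finite_induct)
  case empty
  then show ?case by (simp add: conj_poly_def)
next
  case (insert l t)
  have "eval \<alpha> (lit_poly l) = of_bool (lit_holds \<alpha> l)"
    by (cases l) (auto simp: var_def eval_mon_def)
  then show ?case using insert by (simp add: conj_poly_def)
qed

section \<open>Degree of a satisfiable term\<close>

fun lit_var :: "'v lit \<Rightarrow> 'v" where
  "lit_var (Pos v) = v"
| "lit_var (Neg v) = v"

lemma lit_poly_mult_idem: "lit_poly l * lit_poly l = lit_poly l"
  by (cases l) (simp_all add: var_idem algebra_simps)

lemma conj_poly_insert: "finite t \<Longrightarrow> conj_poly (insert l t) = lit_poly l * conj_poly t"
  by (cases "l \<in> t")
    (simp_all add: conj_poly_def insert_absorb prod.remove lit_poly_mult_idem flip: mult.assoc)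

text \<open>Literal polynomials are idempotent, so shared literals merge. A product of two terms
  thus becomes a single term, to which the degree bound below applies.\<close>

lemma conj_poly_mult: "finite s \<Longrightarrow> finite t \<Longrightarrow> conj_poly s * conj_poly t = conj_poly (s \<union> t)"
proof (induction s rule: finite_induct)
  case empty
  then show ?case by (simp add: conj_poly_def)
next
  case (insert l s)
  then show ?case by (simp add: conj_poly_insert mult.assoc)
qed

text \<open>The literals of a satisfiable term have distinct variables, so the product of all of these
  survives in its polynomial, with coefficient \<open>\<plusminus>1\<close>.\<close>

lemma conj_poly_top:
  assumes "finite t" "\<forall>l\<in>t. lit_holds \<alpha> l"
  shows "\<exists>c q. c \<noteq> 0 \<and> conj_poly t = Poly_Mapping.single (Mon (Abs_fset (lit_var ` t))) c + q \<and>
    (\<forall>m\<in>Poly_Mapping.keys q. fset (mon_vars m) \<subset> lit_var ` t)"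
  using assms
proof (induction t rule: finite_induct)
  case empty
  show ?case
    by (rule exI[of _ 1], rule exI[of _ 0])
      (simp add: conj_poly_def flip: bot_fset_def zero_mlmon_def)
next
  case (insert l t)
  let ?v = "lit_var l" and ?M = "Mon (Abs_fset (lit_var ` t))"
  obtain c q where cq: "c \<noteq> 0" "conj_poly t = Poly_Mapping.single ?M c + q"
    and q: "\<And>m. m \<in> Poly_Mapping.keys q \<Longrightarrow> fset (mon_vars m) \<subset> lit_var ` t"
    using insert by auto
  \<comment> \<open>Two literals on one variable that are both true under \<alpha> coincide.\<close>
  have v: "?v \<notin> lit_var ` t"
  proof
    assume "?v \<in> lit_var ` t"
    then obtain l' where "l' \<in> t" "lit_var l' = ?v" by auto
    then have "l = l'" using insert.prems by (cases l; cases l') auto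
    then show False using insert.hyps \<open>l' \<in> t\<close> by simp
  qed
  have fs: "fset (Abs_fset (lit_var ` t)) = lit_var ` t"
    using insert.hyps by (simp add: Abs_fset_inverse)
  have top: "Mon {|?v|} + ?M = Mon (Abs_fset (lit_var ` insert l t))"
  proof -
    have "fset (Abs_fset (lit_var ` insert l t)) = lit_var ` insert l t"
      using insert.hyps by (subst Abs_fset_inverse) auto
    then show ?thesis by (simp add: plus_mlmon_def fset_inject[symmetric] fs)
  qed
  have vq: "fset (mon_vars m) \<subset> lit_var ` insert l t" if m: "m \<in> Poly_Mapping.keys (var ?v * q)" for m
  proof -
    obtain a m' where "m = a + m'" "a \<in> Poly_Mapping.keys (var ?v)" "m' \<in> Poly_Mapping.keys q"
      using m keys_mult[of "var ?v" q] by blast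
    then have m': "m' \<in> Poly_Mapping.keys q" "m = Mon {|?v|} + m'" by (simp_all add: var_def)
    then have m_eq: "fset (mon_vars m) = insert ?v (fset (mon_vars m'))"
      by (simp add: plus_mlmon_def)
    obtain u where u: "u \<in> lit_var ` t" "u \<notin> fset (mon_vars m')"
      using q[OF m'(1)] by (meson psubset_imp_ex_mem DiffE)
    then have "u \<notin> fset (mon_vars m)" using v m_eq by (metis insertE)
    moreover have "u \<in> lit_var ` insert l t" using u(1) by simp
    moreover have "fset (mon_vars m) \<subseteq> lit_var ` insert l t"
      unfolding m_eq image_insert using q[OF m'(1)] by (intro insert_mono psubset_imp_subset)
    ultimately show ?thesis by (metis psubsetI)
  qed
  have mono: "fset (mon_vars m) \<subset> lit_var ` insert l t" if "fset (mon_vars m) \<subseteq> lit_var ` t" for m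
    using that v by (metis image_insert insertI1 psubsetI subset_iff subset_insertI2)
  have vM: "var ?v * conj_poly t
      = Poly_Mapping.single (Mon (Abs_fset (lit_var ` insert l t))) c + var ?v * q"
    by (simp add: cq(2) distrib_left var_def mult_single top)
  show ?case
  proof (cases l)
    case (Pos u)
    then have eq: "conj_poly (insert l t)
        = Poly_Mapping.single (Mon (Abs_fset (lit_var ` insert l t))) c + var ?v * q"
      using vM insert.hyps by (simp add: conj_poly_insert)
    show ?thesis
      by (rule exI[of _ c], rule exI[of _ "var ?v * q"], intro conjI ballI) (rule cq(1), rule eq, erule vq)
  next
    case (Neg u)
    \<comment> \<open>The factor \<open>1 - var ?v\<close> negates the top coefficient, and the old
      top monomial joins the remainder since it lacks \<open>?v\<close>.\<close>
    let ?q = "Poly_Mapping.single ?M c + q - var ?v * q"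
    have eq: "conj_poly (insert l t)
        = Poly_Mapping.single (Mon (Abs_fset (lit_var ` insert l t))) (- c) + ?q"
      using Neg vM cq(2) insert.hyps by (simp add: conj_poly_insert left_diff_distrib single_uminus)
    have keys: "fset (mon_vars m) \<subset> lit_var ` insert l t" if "m \<in> Poly_Mapping.keys ?q" for m
    proof -
      have "m = ?M \<or> m \<in> Poly_Mapping.keys q \<or> m \<in> Poly_Mapping.keys (var ?v * q)"
        using that keys_diff[of "Poly_Mapping.single ?M c + q" "var ?v * q"]
          keys_add[of "Poly_Mapping.single ?M c" q] by (auto split: if_splits)
      then show ?thesis
      proof (elim disjE)
        assume "m = ?M"
        then show ?thesis by (intro mono) (simp add: fs)
      next
        assume "m \<in> Poly_Mapping.keys q"
        then show ?thesis by (intro mono psubset_imp_subset q)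
      qed (rule vq)
    qed
    show ?thesis
      by (rule exI[of _ "- c"], rule exI[of _ ?q], intro conjI ballI) (simp add: cq(1), rule eq, erule keys)
  qed
qed

text \<open>The product of all variables of the term cannot cancel against smaller monomials.
  Satisfiability matters: a term with both \<open>Pos v\<close> and \<open>Neg v\<close> has
  polynomial 0.\<close>

lemma card_vars_le_mldeg:
  assumes "finite t" "\<forall>l\<in>t. lit_holds \<alpha> l"
  shows "card (lit_var ` t) \<le> mldeg (conj_poly t)"
proof -
  let ?M = "Mon (Abs_fset (lit_var ` t))"
  obtain c q where cq: "c \<noteq> 0" "conj_poly t = Poly_Mapping.single ?M c + q"
    "\<forall>m\<in>Poly_Mapping.keys q. fset (mon_vars m) \<subset> lit_var ` t"
    using conj_poly_top[OF assms] by blast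
  have fs: "fset (mon_vars ?M) = lit_var ` t" using assms(1) by (simp add: Abs_fset_inverse)
  then have "?M \<notin> Poly_Mapping.keys q" using cq(3) by blast
  then have "?M \<in> Poly_Mapping.keys (conj_poly t)"
    using cq(1) by (simp add: cq(2) in_keys_iff lookup_add)
  then have "fcard (mon_vars ?M) \<le> mldeg (conj_poly t)"
    unfolding mldeg_def by (intro Max_ge finite.insertI finite_imageI insertI2 imageI) simp_all
  then show ?thesis using fs by (simp add: fcard.rep_eq)
qed

lemma finite_conj: "finite V \<Longrightarrow> t \<in> conjs V \<Longrightarrow> finite t"
  unfolding conjs_def by (metis PowD finite_UnI finite_imageI finite_subset)

lemma finite_dnf: "finite V \<Longrightarrow> D \<in> dnfs V \<Longrightarrow> finite D"
  unfolding dnfs_def conjs_def by (metis PowD finite_Pow_iff finite_UnI finite_imageI finite_subset)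

text \<open>The constant summand of \<open>D\<close> gives the first bound, its terms give the
  second.\<close>

lemma mldeg_mult_le_prod_degree:
  assumes "finite V" "D \<in> dnfs V" "J \<in> juntas V" "C \<in># J"
  shows "mldeg (conj_poly C) \<le> prod_degree D J"
    and "t \<in> D \<Longrightarrow> mldeg (conj_poly t * conj_poly C) \<le> prod_degree D J"
proof -
  let ?S = "{p * q | p q. p \<in> dnf_summands D \<and> q \<in> junta_summands J}"
  have "?S = (\<lambda>(p, q). p * q) ` (dnf_summands D \<times> junta_summands J)" by auto
  then have "finite ?S"
    using finite_dnf[OF assms(1,2)] by (simp add: dnf_summands_def junta_summands_def)
  then have le: "mldeg r \<le> prod_degree D J" if "r \<in> ?S" for r
    unfolding prod_degree_def sum_degree_def using that by (intro Max_ge) auto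
  have "1 * conj_poly C \<in> ?S"
    using assms(4) unfolding dnf_summands_def junta_summands_def by blast
  then show "mldeg (conj_poly C) \<le> prod_degree D J" using le by fastforce
  show "mldeg (conj_poly t * conj_poly C) \<le> prod_degree D J" if "t \<in> D"
    using that assms(4) by (intro le) (auto simp: dnf_summands_def junta_summands_def)
qed

section \<open>The averaged linear orders\<close>

fun precedes :: "'a list \<Rightarrow> 'a \<Rightarrow> 'a \<Rightarrow> bool" where
  "precedes [] a b \<longleftrightarrow> False"
| "precedes (x # xs) a b \<longleftrightarrow> x = a \<and> b \<in> set xs \<or> precedes xs a b"

lemma precedes_set: "precedes xs a b \<Longrightarrow> a \<in> set xs \<and> b \<in> set xs"
  by (induction xs) auto

lemma precedes_filter:
  "a \<in> X \<Longrightarrow> b \<in> X \<Longrightarrow> precedes (filter (\<lambda>x. x \<in> X) xs) a b = precedes xs a b"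
  by (induction xs) auto

lemma precedes_asym: "distinct xs \<Longrightarrow> precedes xs a b \<Longrightarrow> \<not> precedes xs b a"
  by (induction xs) (auto dest: precedes_set)

lemma precedes_trans:
  "distinct xs \<Longrightarrow> precedes xs a b \<Longrightarrow> precedes xs b c \<Longrightarrow> precedes xs a c"
  by (induction xs) (auto dest: precedes_set)

definition order_assignment :: "'a list \<Rightarrow> 'a \<times> 'a \<Rightarrow> bool" where
  "order_assignment xs = (\<lambda>(a, b). precedes xs a b)"

definition conj_elems :: "('a \<times> 'a) conj \<Rightarrow> 'a set" where
  "conj_elems t = fst ` lit_var ` t \<union> snd ` lit_var ` t"

definition conj_holds :: "'a list \<Rightarrow> ('a \<times> 'a) conj \<Rightarrow> bool" where
  "conj_holds xs t \<longleftrightarrow> (\<forall>l\<in>t. lit_holds (order_assignment xs) l)"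

text \<open>A literal on \<open>(a, b)\<close> depends only on the relative position of
  \<open>a\<close> and \<open>b\<close>, which survives filtering by a set that contains
  both.\<close>

lemma conj_holds_local:
  assumes "filter (\<lambda>x. x \<in> conj_elems t) xs = filter (\<lambda>x. x \<in> conj_elems t) ys"
  shows "conj_holds xs t = conj_holds ys t"
proof -
  have "lit_holds (order_assignment xs) l = lit_holds (order_assignment ys) l" if "l \<in> t" for l
  proof -
    obtain a b where ab: "lit_var l = (a, b)" by fastforce
    then have "a \<in> conj_elems t" "b \<in> conj_elems t" using that by (force simp: conj_elems_def)+
    then have "precedes xs a b = precedes ys a b" using assms precedes_filter by metis
    then show ?thesis using ab by (cases l) (simp_all add: order_assignment_def)
  qed
  then show ?thesis by (simp add: conj_holds_def)
qed

text \<open>A variable is a pair of elements; hence the factor 2 between degree and width.\<close>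

lemma card_conj_elems: "finite t \<Longrightarrow> card (conj_elems t) \<le> 2 * card (lit_var ` t)"
  unfolding conj_elems_def
  using card_Un_le[of "fst ` lit_var ` t" "snd ` lit_var ` t"]
    card_image_le[of "lit_var ` t" fst] card_image_le[of "lit_var ` t" snd]
  by simp

lemma eval_dnf_poly:
  assumes "finite V" "D \<in> dnfs V"
  shows "eval (order_assignment xs) (dnf_poly D) = real (card {t \<in> D. conj_holds xs t}) - 1"
proof -
  have "eval (order_assignment xs) (conj_poly t) = of_bool (conj_holds xs t)" if "t \<in> D" for t
    using that assms finite_conj[OF assms(1)] by (subst eval_conj_poly) (auto simp: dnfs_def conj_holds_def)
  then show ?thesis
    using finite_dnf[OF assms] by (simp add: dnf_poly_def eval_sum sum_of_bool_eq Int_def)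
qed

section \<open>Mean over all orders, and the axioms at an order\<close>

definition order_mean :: "nat \<Rightarrow> (nat \<times> nat) mlpoly \<Rightarrow> real" where
  "order_mean n p = (\<Sum>xs\<in>permutations_of_set {1..n}. eval (order_assignment xs) p) / fact n"

lemma linear_order_mean: "linear (order_mean n)"
  by (rule linearI)
    (simp_all add: order_mean_def sum.distrib add_divide_distrib flip: sum_distrib_left)

lemma order_mean_one: "order_mean n 1 = 1"
  by (simp add: order_mean_def)

text \<open>Linearity reduces juntas to single terms; \<open>p = 1\<close> covers the juntas
  themselves.\<close>

lemma order_mean_junta_nonneg:
  assumes "\<And>C. C \<in># J \<Longrightarrow> 0 \<le> order_mean n (p * conj_poly C)"
  shows "0 \<le> order_mean n (p * junta_poly J)"
  using assms
proof (induction J)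
  case empty
  then show ?case by (simp add: junta_poly_def linear_0[OF linear_order_mean])
next
  case (add C J)
  then show ?case
    by (simp add: junta_poly_def distrib_left linear_add[OF linear_order_mean])
qed

lemma dnf_holds_clause: "dnf_holds \<alpha> (clause L) \<longleftrightarrow> (\<exists>l\<in>L. lit_holds \<alpha> l)"
  by (simp add: dnf_holds_def clause_def)

text \<open>The axioms \<open>R\<close> and \<open>A\<close> hold by asymmetry, \<open>T\<close> by
  transitivity, and \<open>O\<close> is a tautology; the case \<open>min\<close> is left for the
  axioms \<open>M\<close>.\<close>

lemma LOP_cases:
  assumes "D \<in> LOP n"
  obtains (min) i where "i \<in> {1..n}" "D = clause {Pos (j, i) | j. j \<in> {1..n} - {i}}"
  | (holds) "\<And>xs. distinct xs \<Longrightarrow> dnf_holds (order_assignment xs) D"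
proof -
  consider (M) i where "i \<in> {1..n}" "D = clause {Pos (j, i) | j. j \<in> {1..n} - {i}}"
    | (R) i where "D = clause {Neg (i, i)}"
    | (A) i j where "D = clause {Neg (i, j), Neg (j, i)}"
    | (T) i j k where "D = clause {Pos (i, k), Neg (i, j), Neg (j, k)}"
    | (O) i j where "D = clause {Pos (i, j), Neg (i, j)}"
    using assms unfolding LOP_def by blast
  then show thesis
  proof cases
    case M
    then show thesis by (rule min)
  next
    case R
    then show thesis
      by (intro holds) (auto simp: dnf_holds_clause order_assignment_def dest: precedes_asym)
  next
    case A
    then show thesis
      by (intro holds) (auto simp: dnf_holds_clause order_assignment_def dest: precedes_asym)
  next
    case T
    then show thesis
      by (intro holds) (auto simp: dnf_holds_clause order_assignment_def dest: precedes_trans)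
  next
    case O
    then show thesis by (intro holds) (simp add: dnf_holds_clause)
  qed
qed

text \<open>If the axiom holds at every order, so does its weakening, and every summand is
  nonnegative. For a weakened \<open>M\<close> the core inequality applies, with \<open>d\<close>
  the degree of the product.\<close>

lemma weakened_axiom_mean_nonneg:
  fixes n :: nat
  assumes n: "n \<noteq> 1" and D: "D \<in> LOP n" and D': "D' \<in> dnfs (lop_vars n)" "dnf_implies D D'"
    and J: "J \<in> juntas (lop_vars n)" "C \<in># J" and deg: "real (prod_degree D' J) \<le> real n / 300"
  shows "0 \<le> order_mean n (dnf_poly D' * conj_poly C)"
proof -
  let ?P = "permutations_of_set {1..n}"
  have fV: "finite (lop_vars n)" by (simp add: lop_vars_def)
  have fin: "finite t" if "t \<in> insert C D'" for t
    using that D'(1) J finite_conj[OF fV] by (auto simp: dnfs_def juntas_def)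
  have fD: "finite D'" using finite_dnf[OF fV D'(1)] .
  have eval: "eval (order_assignment xs) (dnf_poly D' * conj_poly C)
      = of_bool (conj_holds xs C) * (real (card {t \<in> D'. conj_holds xs t}) - 1)" for xs
    using fin by (simp add: eval_dnf_poly[OF fV D'(1)] eval_conj_poly conj_holds_def)
  have "0 \<le> (\<Sum>xs\<in>?P. of_bool (conj_holds xs C) * (real (card {t \<in> D'. conj_holds xs t}) - 1))"
    using D
  proof (cases rule: LOP_cases)
    case holds
    show ?thesis
    proof (intro sum_nonneg)
      fix xs assume "xs \<in> ?P"
      then have "dnf_holds (order_assignment xs) D'"
        using holds D'(2) permutations_of_setD(2) by (auto simp: dnf_implies_def)
      then have "\<exists>t\<in>D'. conj_holds xs t" by (simp add: dnf_holds_def conj_holds_def)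
      then have "card {t \<in> D'. conj_holds xs t} > 0" using fD by (auto simp: card_gt_0_iff)
      then show "0 \<le> of_bool (conj_holds xs C) * (real (card {t \<in> D'. conj_holds xs t}) - 1)"
        by simp
    qed
  next
    case (min i)
    define d where "d = prod_degree D' J"
    show ?thesis
    proof (rule sum_satisfied_terms_ge[where el = conj_elems and i = i and d = d])
      show "finite {1..n}" "i \<in> {1..n}" "finite D'" using min fD by auto
      \<comment> \<open>For \<open>n = 1\<close> there would be no element to move below
        \<open>i\<close>.\<close>
      show "card {1..n} \<ge> 2" using min n by auto
      show "300 * d \<le> card {1..n}" using deg by (simp add: d_def field_simps flip: of_nat_le_iff)
      show "conj_holds xs t = conj_holds ys t"
        if "filter (\<lambda>x. x \<in> conj_elems t) xs = filter (\<lambda>x. x \<in> conj_elems t) ys" for xs ys t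
        using that by (rule conj_holds_local)
      show "finite (conj_elems t) \<and> card (conj_elems t) \<le> 2 * d"
        if "conj_holds xs C" "t \<in> insert C D'" "conj_holds xs t" for xs t
      proof -
        \<comment> \<open>The degree of the product is used rather than that of \<open>t\<close>:
          since \<open>t\<close> and \<open>C\<close> hold together, \<open>t \<union> C\<close> is
          satisfiable, so its degree bounds its number of variables and with it that of
          \<open>t\<close>.\<close>
        have "mldeg (conj_poly t * conj_poly C) \<le> d"
        proof (cases "t = C")
          case True
          then show ?thesis
            using mldeg_mult_le_prod_degree(1)[OF fV D'(1) J] fin[of C]
            by (simp add: d_def conj_poly_mult)
        next
          case False
          then show ?thesis
            using mldeg_mult_le_prod_degree(2)[OF fV D'(1) J] that by (simp add: d_def)
        qed
        moreover have "card (lit_var ` (t \<union> C)) \<le> mldeg (conj_poly (t \<union> C))"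
          using that fin by (intro card_vars_le_mldeg[of _ "order_assignment xs"]) (auto simp: conj_holds_def)
        moreover have "card (lit_var ` t) \<le> card (lit_var ` (t \<union> C))"
          using that fin by (intro card_mono) auto
        ultimately have "card (lit_var ` t) \<le> d" using that fin by (simp add: conj_poly_mult)
        then show ?thesis
          using card_conj_elems[of t] fin[OF that(2)] by (auto simp: conj_elems_def)
      qed
      \<comment> \<open>A least element \<open>x \<noteq> i\<close> precedes \<open>i\<close>, so
        the literal \<open>Pos (x, i)\<close> makes the axiom true, and with it the
        weakening.\<close>
      show "\<exists>t\<in>D'. conj_holds (x # xs) t" if "x # xs \<in> ?P" "x \<noteq> i" for x xs
      proof -
        have "set (x # xs) = {1..n}" using that(1) by (rule permutations_of_setD)
        then have "x \<in> {1..n} - {i}" "i \<in> set xs"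
          using that(2) min(1) by (metis DiffI list.set_intros(1) singletonD, metis set_ConsD)
        then have "dnf_holds (order_assignment (x # xs)) D"
          unfolding min(2) dnf_holds_clause by (force simp: order_assignment_def)
        then show ?thesis using D'(2) by (auto simp: dnf_implies_def dnf_holds_def conj_holds_def)
      qed
    qed
  qed
  then show ?thesis by (simp only: order_mean_def eval divide_nonneg_pos fact_gt_zero)
qed

theorem theorem4p1:
  fixes n :: nat
  assumes "n \<noteq> 1"
  shows "\<exists>E. sigma2_pseudo_expectation (lop_vars n) (real n / 300) (LOP n) E"
proof -
  have fV: "finite (lop_vars n)" by (simp add: lop_vars_def)
  have "pseudo_expectation (lop_vars n) (real n / 300) (\<Union>D\<in>LOP n. W D) (order_mean n)"
    if W: "weakening (lop_vars n) (LOP n) W" for W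
    unfolding pseudo_expectation_def
  proof (intro conjI ballI impI)
    show "linear (order_mean n)" "order_mean n 1 = 1"
      by (rule linear_order_mean order_mean_one)+
  next
    fix J assume J: "J \<in> juntas (lop_vars n)"
    \<comment> \<open>The factor 1 brings the claim into the form required by
      \<open>order_mean_junta_nonneg\<close>.\<close>
    have "0 \<le> order_mean n (1 * conj_poly C)" if "C \<in># J" for C
      using that J finite_conj[OF fV]
      by (auto simp: order_mean_def juntas_def eval_conj_poly intro!: divide_nonneg_pos sum_nonneg)
    then show "0 \<le> order_mean n (junta_poly J)"
      using order_mean_junta_nonneg[of J n 1] by simp
  next
    fix D' J
    assume "D' \<in> (\<Union>D\<in>LOP n. W D)" and J: "J \<in> juntas (lop_vars n)"
      and deg: "real (prod_degree D' J) \<le> real n / 300"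
    then obtain D where "D \<in> LOP n" "D' \<in> dnfs (lop_vars n)" "dnf_implies D D'"
      using W unfolding weakening_def dnf_weakening_def by blast
    then show "0 \<le> order_mean n (dnf_poly D' * junta_poly J)"
      using assms J deg by (intro order_mean_junta_nonneg weakened_axiom_mean_nonneg)
  qed
  then have "sigma2_pseudo_expectation (lop_vars n) (real n / 300) (LOP n) (\<lambda>_. order_mean n)"
    unfolding sigma2_pseudo_expectation_def by blast
  then show ?thesis by blast
qed

end
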